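(* Let $X$ be a Banach space and let $\mathcal K\subset X$ be a compact subset with $\sup_{f\in\mathcal K}\|f\|_X=1$. Then the following hold. (1) Let $\alpha>0$, $\beta\in\mathbb R$, $C>0$. If $e_n(\mathcal K)_X\ge C\,\dfrac{[\log_2 n]^\beta}{n^\alpha}$ for all $n=2,3,\ldots$, then there is a constant $C'>0$, independent of $n$, such that $d_n(\mathcal K)_X\ge C'\,\dfrac{[\log_2 n]^{\beta}}{n^\alpha[\log_2 n]^\alpha}$ for all $n=2,3,\ldots$. (2) Let $\alpha>0$, $C>0$. If $e_n(\mathcal K)_X\ge \dfrac{C}{[\log_2 n]^\alpha}$ for all $n=2,3,\ldots$, then there is a constant $C'>0$, independent of $n$, such that $d_n(\mathcal K)_X\ge \dfrac{C'}{[\log_2 n]^\alpha}$ for all $n=2,3,\ldots$. (3) Let $0<\alpha<1$ and $C,c>0$. If $e_n(\mathcal K)_X\ge C\,2^{-cn^\alpha}$ for all $n=1,2,\ldots$, then there are constants $C',c'>0$, independent of $n$, such that $d_n(\mathcal K)_X\ge C'\,2^{-c'n^{\alpha/(1-\alpha)}}$ for all $n=1,2,\ldots$.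
   Context: All linear spaces are over the real numbers. For a compact set $\mathcal K\subset X$ the entropy numbers are $$e_n(\mathcal K)_X=\inf\Big\{\epsilon>0:\ \mathcal K\subset\bigcup_{j=1}^{2^n}B(g_j,\epsilon)\ \text{for some } g_1,\ldots,g_{2^n}\in X\Big\},\quad n\ge 0,$$ where $B(g,\epsilon)=\{f\in X:\|f-g\|_X\le\epsilon\}$. The (linear) Kolmogorov $n$-width is $$d_0(\mathcal K)_X=\sup_{f\in\mathcal K}\|f\|_X,\qquad d_n(\mathcal K)_X=\inf_{\dim X_n=n}\ \sup_{f\in\mathcal K}\operatorname{dist}(f,X_n)_X,\quad n\ge1,$$ where the infimum is over all linear subspaces $X_n\subset X$ of dimension $n$. The constants $C',c'$ may depend on $\mathcal K$ and on $\alpha,\beta,C,c$, but not on $n$. *)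

theory Defs
  imports "HOL-Analysis.Analysis"
begin

text \<open>Both quantities are extended reals, so that infima over empty families are \<open>\<infinity>\<close>: no finite
  cover of \<open>K\<close> by \<open>\<epsilon>\<close>-balls, or no \<open>n\<close>-dimensional subspace because the ambient space is too small.\<close>

definition entropy_number :: "nat \<Rightarrow> 'a::real_normed_vector set \<Rightarrow> ereal" where
  "entropy_number n K =
     Inf {ereal \<epsilon> | \<epsilon>. \<epsilon> > 0 \<and> (\<exists>g :: nat \<Rightarrow> 'a. K \<subseteq> (\<Union>j\<in>{1..2 ^ n}. cball (g j) \<epsilon>))}"

text \<open>The library's \<open>dim\<close> is \<open>0\<close> on infinite-dimensional subspaces; for \<open>n \<ge> 1\<close> the condition
  \<open>dim V = n\<close> therefore forces \<open>V\<close> to be finite-dimensional, and \<open>n = 0\<close> is a separate case.\<close>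

definition kolmogorov_width :: "nat \<Rightarrow> 'a::real_normed_vector set \<Rightarrow> ereal" where
  "kolmogorov_width n K =
     (if n = 0 then (SUP f\<in>K. ereal (norm f))
      else (INF V\<in>{V. subspace V \<and> dim V = n}. SUP f\<in>K. ereal (infdist f V)))"

end

theory Submission
  imports Defs "HOL-Real_Asymp.Real_Asymp"
begin

text \<open>If an \<open>n\<close>-dimensional subspace comes within \<open>\<delta>\<close> of every point of \<open>K\<close>, then \<open>K\<close> is covered by the
  \<open>2\<delta>\<close>-balls around a \<open>\<delta>\<close>-net of a bounded part of that subspace, and such a net needs only \<open>(8/\<delta>)^n\<close> points.
  Hence \<open>d\<^sub>n < \<delta> \<le> 1\<close> forces \<open>e\<^sub>m \<le> 2\<delta>\<close> as soon as \<open>m \<ge> n log 2 (8/\<delta>)\<close>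
  (\<open>entropy_number_le_of_width_less\<close>). Choosing for \<open>\<delta>\<close> the claimed lower bound for \<open>d\<^sub>n\<close> with a small enough
  constant, the assumed lower bound for \<open>e\<^sub>m\<close> exceeds \<open>2\<delta>\<close>, a contradiction. For polynomial and logarithmic
  rates \<open>m\<close> is of order \<open>n log n\<close>, which costs the factor \<open>(log n)^\<alpha>\<close> in the first rate and only a constant
  in the second (\<open>width_ge_log_rate\<close>); for \<open>\<delta> \<approx> exp (- n^\<gamma>)\<close> it is of order \<open>n^(1+\<gamma>)\<close>, whence the
  exponent \<open>\<gamma>\<close> with \<open>\<alpha> (1 + \<gamma>) = \<gamma>\<close> (\<open>width_ge_exponential_rate\<close>).

  The covering count has to be uniform over all \<open>n\<close>-dimensional normed spaces
  (\<open>card_separated_unit_ball\<close>). It is usually read off from volumes. Here it follows from a bound with the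
  right exponent but a constant depending on the space, obtained by rounding coordinates
  (\<open>card_separated_polynomial\<close>), by a tensor-power argument: expansions in base \<open>4/\<delta>\<close> with digits
  in a \<open>\<delta>\<close>-separated set form large separated sets at arbitrarily fine scales, where the constant is
  negligible.\<close>

section \<open>Coordinates in a finite-dimensional span\<close>

text \<open>Induction on the basis. When a vector \<open>b\<close> is added, the coordinates with respect to the old basis \<open>B\<close>
  are Lipschitz, so a sequence in \<open>span B\<close> converging to \<open>b\<close> would have convergent coordinates and \<open>b\<close>
  would lie in \<open>span B\<close>. Hence \<open>b\<close> has positive distance \<open>d\<close> from \<open>span B\<close>, and this bounds the new
  coordinate by \<open>1/d\<close> times the norm.\<close>

lemma coordinates_bounded_by_norm:
  fixes B :: "'a::real_normed_vector set"
  assumes "finite B" "independent B"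
  shows "\<exists>L>0. \<forall>c. \<forall>b\<in>B. \<bar>c b\<bar> \<le> L * norm (\<Sum>x\<in>B. c x *\<^sub>R x)"
  using assms
proof (induction B rule: finite_induct)
  case empty
  show ?case by (intro exI[of _ 1]) auto
next
  case (insert b B)
  then have indB: "independent B" and bnot: "b \<notin> span B"
    by (auto simp: independent_insert)
  from insert.IH[OF indB] obtain L where L: "L > 0"
    and Lb: "\<And>c x. x \<in> B \<Longrightarrow> \<bar>c x\<bar> \<le> L * norm (\<Sum>y\<in>B. c y *\<^sub>R y)" by blast
  have "b \<notin> closure (span B)"
  proof
    assume "b \<in> closure (span B)"
    then obtain v where v: "\<And>k. v k \<in> span B" and lim: "v \<longlonglongrightarrow> b"
      by (auto simp: closure_sequential)
    have "\<forall>k. \<exists>c. v k = (\<Sum>y\<in>B. c y *\<^sub>R y)"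
      using v by (auto simp: span_finite[OF insert.hyps(1)])
    then obtain c where c: "\<And>k. v k = (\<Sum>y\<in>B. c k y *\<^sub>R y)" by metis
    have "convergent (\<lambda>k. c k y)" if y: "y \<in> B" for y
    proof (rule Cauchy_convergent, rule metric_CauchyI)
      fix e :: real assume e: "e > 0"
      from LIMSEQ_imp_Cauchy[OF lim] have "Cauchy v" .
      then obtain M where M: "\<And>m n. m \<ge> M \<Longrightarrow> n \<ge> M \<Longrightarrow> dist (v m) (v n) < e / L"
        using metric_CauchyD[of v "e / L"] e L by auto
      have "dist (c m y) (c n y) < e" if "m \<ge> M" "n \<ge> M" for m n
      proof -
        have "\<bar>c m y - c n y\<bar> \<le> L * norm (\<Sum>z\<in>B. (c m z - c n z) *\<^sub>R z)"
          using Lb[OF y, of "\<lambda>z. c m z - c n z"] .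
        also have "(\<Sum>z\<in>B. (c m z - c n z) *\<^sub>R z) = v m - v n"
          by (simp add: c scaleR_diff_left sum_subtractf)
        also have "L * norm (v m - v n) < e"
          using M[OF that] L by (simp add: dist_norm field_simps)
        finally show ?thesis by (simp add: dist_real_def)
      qed
      then show "\<exists>M. \<forall>m\<ge>M. \<forall>n\<ge>M. dist (c m y) (c n y) < e" by blast
    qed
    then have "\<And>y. y \<in> B \<Longrightarrow> (\<lambda>k. c k y) \<longlonglongrightarrow> lim (\<lambda>k. c k y)"
      by (simp add: convergent_LIMSEQ_iff)
    then have "(\<lambda>k. \<Sum>y\<in>B. c k y *\<^sub>R y) \<longlonglongrightarrow> (\<Sum>y\<in>B. lim (\<lambda>k. c k y) *\<^sub>R y)"
      by (intro tendsto_sum tendsto_scaleR) auto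
    moreover have "(\<lambda>k. \<Sum>y\<in>B. c k y *\<^sub>R y) = v" using c by auto
    ultimately have "b = (\<Sum>y\<in>B. lim (\<lambda>k. c k y) *\<^sub>R y)"
      using lim LIMSEQ_unique by auto
    then have "b \<in> span B"
      by (auto intro: span_sum span_scale span_base)
    with bnot show False by simp
  qed
  moreover have ne: "span B \<noteq> {}" using span_zero by blast
  ultimately have "infdist b (span B) > 0"
    using in_closure_iff_infdist_zero[OF ne, of b] infdist_nonneg[of b "span B"] by linarith
  then obtain d where d: "d > 0" and dle: "\<And>w. w \<in> span B \<Longrightarrow> d \<le> norm (b - w)"
    using infdist_le[of _ "span B" b] by (metis dist_norm)
  define L' where "L' = 1 / d + L * (1 + norm b / d)"
  have "\<bar>c y\<bar> \<le> L' * norm (\<Sum>x\<in>insert b B. c x *\<^sub>R x)" if y: "y \<in> insert b B" for c y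
  proof -
    define w where "w = (\<Sum>x\<in>B. c x *\<^sub>R x)"
    define v where "v = (\<Sum>x\<in>insert b B. c x *\<^sub>R x)"
    have v: "v = c b *\<^sub>R b + w" using insert.hyps by (simp add: v_def w_def)
    have w: "w \<in> span B" unfolding w_def by (auto intro: span_sum span_scale span_base)
    have cb: "\<bar>c b\<bar> * d \<le> norm v"
    proof (cases "c b = 0")
      case False
      have "d \<le> norm (b - (- inverse (c b)) *\<^sub>R w)"
        by (rule dle) (use w in \<open>blast intro: span_scale\<close>)
      then have "\<bar>c b\<bar> * d \<le> norm (c b *\<^sub>R (b - (- inverse (c b)) *\<^sub>R w))"
        by (simp add: mult_left_mono)
      also have "c b *\<^sub>R (b - (- inverse (c b)) *\<^sub>R w) = v"
        using False by (simp add: v scaleR_add_right)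
      finally show ?thesis .
    qed simp
    then have cb': "\<bar>c b\<bar> \<le> norm v / d" using d by (simp add: field_simps)
    have "norm w \<le> norm v + \<bar>c b\<bar> * norm b"
      using norm_triangle_ineq4[of v "c b *\<^sub>R b"] by (simp add: v)
    also have "\<dots> \<le> norm v + norm v / d * norm b"
      using cb' by (intro add_mono mult_right_mono) auto
    finally have "L * norm w \<le> L * (norm v + norm v / d * norm b)"
      using L by (simp add: mult_left_mono)
    then have w': "L * norm w \<le> L * (1 + norm b / d) * norm v" by (simp add: algebra_simps)
    have L'v: "L' * norm v = norm v / d + L * (1 + norm b / d) * norm v"
      by (simp add: L'_def algebra_simps)
    have "0 \<le> norm v / d" "0 \<le> L * (1 + norm b / d) * norm v"
      using d L by auto
    moreover have "\<bar>c y\<bar> \<le> norm v / d \<or> \<bar>c y\<bar> \<le> L * norm w"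
      using y cb' Lb[of y c] by (auto simp: w_def)
    ultimately have "\<bar>c y\<bar> \<le> L' * norm v" using w' L'v by linarith
    then show ?thesis by (simp add: v_def)
  qed
  moreover have "L' > 0" using d L by (auto simp: L'_def add_pos_nonneg)
  ultimately show ?case by blast
qed

section \<open>Packing the unit ball of an n-dimensional space\<close>

text \<open>Rounding the coordinates down to multiples of a small multiple of \<open>\<eta>\<close> is injective on an
  \<open>\<eta>\<close>-separated set, and takes \<open>O(1/\<eta>)\<close> values in each coordinate.\<close>

lemma card_separated_polynomial:
  fixes B :: "'a::real_normed_vector set"
  assumes B: "finite B" "independent B" and R: "R > 0"
  shows "\<exists>C>0. \<forall>S \<eta>. S \<subseteq> span B \<inter> cball 0 R \<longrightarrow> 0 < \<eta> \<longrightarrow> \<eta> \<le> 1 \<longrightarrow>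
           pairwise (\<lambda>x y. \<eta> \<le> dist x y) S \<longrightarrow> finite S \<and> real (card S) \<le> C / \<eta> ^ card B"
proof -
  obtain L where L: "L > 0"
    and Lb: "\<And>c x. x \<in> B \<Longrightarrow> \<bar>c x\<bar> \<le> L * norm (\<Sum>y\<in>B. c y *\<^sub>R y)"
    using coordinates_bounded_by_norm[OF B] by blast
  define T where "T = 1 + (\<Sum>b\<in>B. norm b)"
  have T: "T \<ge> 1" by (simp add: T_def sum_nonneg)
  have "finite S \<and> real (card S) \<le> (2 * L * R * T + 3) ^ card B / \<eta> ^ card B"
    if S: "S \<subseteq> span B \<inter> cball 0 R" and \<eta>: "0 < \<eta>" "\<eta> \<le> 1"
      and sep: "pairwise (\<lambda>x y. \<eta> \<le> dist x y) S" for S \<eta>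
  proof -
    have "\<forall>v\<in>S. \<exists>c. v = (\<Sum>y\<in>B. c y *\<^sub>R y)"
      using S by (auto simp: span_finite[OF B(1)])
    then obtain c where c: "\<And>v. v \<in> S \<Longrightarrow> v = (\<Sum>y\<in>B. c v y *\<^sub>R y)" by metis
    define F where "F = (\<lambda>v. \<lambda>b\<in>B. \<lfloor>c v b * T / \<eta>\<rfloor>)"
    define k where "k = \<lceil>L * R * T / \<eta>\<rceil>"
    have "0 \<le> L * R * T / \<eta>" using L R T \<eta> by (intro divide_nonneg_pos mult_nonneg_nonneg) auto
    then have kpos: "k \<ge> 0" unfolding k_def by linarith
    have inj: "inj_on F S"
    proof (rule inj_onI, rule ccontr)
      fix v w assume v: "v \<in> S" and w: "w \<in> S" and eq: "F v = F w" and ne: "v \<noteq> w"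
      have diff: "\<bar>c v b - c w b\<bar> \<le> \<eta> / T" if b: "b \<in> B" for b
      proof -
        have "\<lfloor>c v b * T / \<eta>\<rfloor> = \<lfloor>c w b * T / \<eta>\<rfloor>"
          using fun_cong[OF eq, of b] b by (simp add: F_def)
        then have "\<bar>c v b * T / \<eta> - c w b * T / \<eta>\<bar> < 1" by linarith
        also have "c v b * T / \<eta> - c w b * T / \<eta> = (c v b - c w b) * (T / \<eta>)"
          by (simp add: algebra_simps diff_divide_distrib)
        finally have "\<bar>c v b - c w b\<bar> * (T / \<eta>) < 1" using T \<eta> by (simp add: abs_mult)
        then show ?thesis using T \<eta> by (simp add: field_simps)
      qed
      have "v - w = (\<Sum>b\<in>B. (c v b - c w b) *\<^sub>R b)"
        by (subst c[OF v], subst c[OF w]) (simp add: scaleR_diff_left sum_subtractf)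
      then have "dist v w \<le> (\<Sum>b\<in>B. \<bar>c v b - c w b\<bar> * norm b)"
        using norm_sum[of "\<lambda>b. (c v b - c w b) *\<^sub>R b" B] by (simp add: dist_norm)
      also have "\<dots> \<le> (\<Sum>b\<in>B. \<eta> / T * norm b)"
        by (intro sum_mono mult_right_mono diff) auto
      also have "\<dots> = \<eta> / T * (T - 1)" by (simp add: T_def sum_distrib_left)
      also have "\<dots> < \<eta>" using T \<eta> by (simp add: field_simps)
      finally show False using pairwiseD[OF sep v w ne] by simp
    qed
    have sub: "F ` S \<subseteq> (\<Pi>\<^sub>E b\<in>B. {-k..k})"
    proof (intro image_subsetI)
      fix v assume v: "v \<in> S"
      have "\<lfloor>c v b * T / \<eta>\<rfloor> \<in> {-k..k}" if b: "b \<in> B" for b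
      proof -
        have "\<bar>c v b\<bar> \<le> L * norm v" using Lb[OF b, of "c v"] c[OF v] by simp
        also have "\<dots> \<le> L * R" using S v L by (auto intro!: mult_left_mono)
        finally have "\<bar>c v b\<bar> * (T / \<eta>) \<le> L * R * (T / \<eta>)"
          using T \<eta> by (intro mult_right_mono) auto
        then have "\<bar>c v b * T / \<eta>\<bar> \<le> L * R * T / \<eta>" using T \<eta> by (simp add: abs_mult)
        also have "\<dots> \<le> real_of_int k" by (simp add: k_def)
        finally have "\<bar>c v b * T / \<eta>\<bar> \<le> real_of_int k" .
        then have "- real_of_int k \<le> c v b * T / \<eta>" "c v b * T / \<eta> \<le> real_of_int k"
          by (auto simp only: abs_le_iff)
        then show ?thesis by (auto simp: le_floor_iff floor_le_iff)
      qed
      then show "F v \<in> (\<Pi>\<^sub>E b\<in>B. {-k..k})" by (auto simp: F_def)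
    qed
    have finP: "finite (\<Pi>\<^sub>E b\<in>B. {-k..k})" using B by (intro finite_PiE) auto
    have fin: "finite S" using inj sub finP finite_imageD finite_subset by metis
    have "card S = card (F ` S)" using inj by (simp add: card_image)
    also have "\<dots> \<le> card (\<Pi>\<^sub>E b\<in>B. {-k..k})" by (rule card_mono[OF finP sub])
    also have "\<dots> = nat (2 * k + 1) ^ card B" using B by (simp add: card_PiE algebra_simps)
    finally have "real (card S) \<le> real (nat (2 * k + 1)) ^ card B"
      by (metis of_nat_le_iff of_nat_power)
    also have "\<dots> \<le> ((2 * L * R * T + 3) / \<eta>) ^ card B"
    proof (rule power_mono)
      have "real (nat (2 * k + 1)) = 2 * real_of_int k + 1" using kpos by simp
      also have "\<dots> \<le> 2 * (L * R * T / \<eta> + 1) + 1"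
        unfolding k_def by (intro add_mono mult_left_mono of_int_ceiling_le_add_one) auto
      also have "\<dots> = 2 * L * R * T / \<eta> + 3 * 1" by simp
      also have "\<dots> \<le> 2 * L * R * T / \<eta> + 3 * (1 / \<eta>)"
        using \<eta> by (intro add_mono mult_left_mono) auto
      also have "\<dots> = (2 * L * R * T + 3) / \<eta>" by (simp add: add_divide_distrib)
      finally show "real (nat (2 * k + 1)) \<le> (2 * L * R * T + 3) / \<eta>" .
    qed simp
    finally show ?thesis using fin by (simp add: power_divide)
  qed
  moreover have "(2 * L * R * T + 3) ^ card B > 0"
    using L R T by (intro zero_less_power add_nonneg_pos mult_nonneg_nonneg) auto
  ultimately show ?thesis by blast
qed

text \<open>The sums \<open>\<Sum>i<k. q^i s(i)\<close> with all digits \<open>s(i)\<close> in \<open>S\<close>; the recursion splits off the leading digit, which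
  decides the separation of two sums.\<close>

fun digit_sums :: "real \<Rightarrow> 'a::real_normed_vector set \<Rightarrow> nat \<Rightarrow> 'a set" where
  "digit_sums q S 0 = {0}"
| "digit_sums q S (Suc k) = (\<lambda>(s, e). s + q *\<^sub>R e) ` (S \<times> digit_sums q S k)"

text \<open>With \<open>q = \<delta>/4\<close>, the tail after a digit has norm at most \<open>q \<cdot> 4/3 = \<delta>/3\<close>, so two sums whose first digits
  differ stay \<open>\<delta> - 2\<delta>/3 \<ge> q\<close> apart. In particular distinct digit strings give distinct sums.\<close>

lemma digit_sums_separated:
  fixes S :: "'a::real_normed_vector set"
  assumes V: "subspace V" and S: "S \<subseteq> V \<inter> cball 0 1" "finite S"
    and \<delta>: "0 < \<delta>" "\<delta> \<le> 1" and sep: "pairwise (\<lambda>x y. \<delta> \<le> dist x y) S"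
  defines "E \<equiv> digit_sums (\<delta> / 4) S"
  shows "E k \<subseteq> V \<inter> cball 0 (4 / 3) \<and> finite (E k) \<and> card (E k) = card S ^ k \<and>
         pairwise (\<lambda>x y. (\<delta> / 4) ^ k \<le> dist x y) (E k)"
proof (induction k)
  case 0
  show ?case using V by (auto simp: E_def subspace_0)
next
  case (Suc k)
  define q where "q = \<delta> / 4"
  have q: "q > 0" "q \<le> 1" using \<delta> by (auto simp: q_def)
  have Suc_E: "E (Suc k) = (\<lambda>(s, e). s + q *\<^sub>R e) ` (S \<times> E k)" by (simp add: E_def q_def)
  have norm_E: "norm (q *\<^sub>R e) \<le> \<delta> / 3" if "e \<in> E k" for e
  proof -
    have "norm e \<le> 4 / 3" using Suc that by auto
    then have "q * norm e \<le> q * (4 / 3)" using q by (intro mult_left_mono) auto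
    then show ?thesis using q by (simp add: q_def)
  qed
  have apart: "q ^ Suc k \<le> dist (s + q *\<^sub>R e) (s' + q *\<^sub>R e')"
    if "s \<in> S" "s' \<in> S" "e \<in> E k" "e' \<in> E k" "(s, e) \<noteq> (s', e')" for s s' e e'
  proof (cases "s = s'")
    case True
    then have "q ^ k \<le> dist e e'" using Suc that by (auto simp: pairwise_def q_def)
    then have "q * q ^ k \<le> q * dist e e'" using q by (intro mult_left_mono) auto
    also have "\<dots> = dist (s + q *\<^sub>R e) (s' + q *\<^sub>R e')"
      using True q by (simp add: dist_norm flip: scaleR_diff_right)
    finally show ?thesis by simp
  next
    case False
    then have "\<delta> \<le> norm (s - s')" using sep that by (auto simp: pairwise_def dist_norm)
    also have "s - s' = (s + q *\<^sub>R e) - (s' + q *\<^sub>R e') - q *\<^sub>R e + q *\<^sub>R e'" by simp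
    also have "norm \<dots> \<le> norm ((s + q *\<^sub>R e) - (s' + q *\<^sub>R e')) + norm (q *\<^sub>R e) + norm (q *\<^sub>R e')"
      by (meson add_right_mono norm_triangle_ineq norm_triangle_ineq4 order_trans)
    also have "\<dots> \<le> dist (s + q *\<^sub>R e) (s' + q *\<^sub>R e') + \<delta> / 3 + \<delta> / 3"
      using norm_E that by (intro add_mono) (auto simp: dist_norm)
    finally have "q \<le> dist (s + q *\<^sub>R e) (s' + q *\<^sub>R e')" using \<delta> by (simp add: q_def)
    moreover have "q ^ Suc k \<le> q" using q by (simp add: mult_left_le power_le_one)
    ultimately show ?thesis by linarith
  qed
  have inj: "inj_on (\<lambda>(s, e). s + q *\<^sub>R e) (S \<times> E k)"
  proof (rule inj_onI)
    fix x y assume "x \<in> S \<times> E k" "y \<in> S \<times> E k"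
      and "(case x of (s, e) \<Rightarrow> s + q *\<^sub>R e) = (case y of (s, e) \<Rightarrow> s + q *\<^sub>R e)"
    moreover have "\<not> q ^ Suc k \<le> 0" using q by (simp add: not_le del: power_Suc)
    ultimately show "x = y"
      using apart[of "fst x" "fst y" "snd x" "snd y"] by (auto split: prod.splits)
  qed
  have "E (Suc k) \<subseteq> V \<inter> cball 0 (4 / 3)"
  proof
    fix x assume "x \<in> E (Suc k)"
    then obtain s e where x: "x = s + q *\<^sub>R e" and s: "s \<in> S" and e: "e \<in> E k"
      by (auto simp: Suc_E)
    have "norm x \<le> norm s + norm (q *\<^sub>R e)" unfolding x by (rule norm_triangle_ineq)
    also have "\<dots> \<le> 1 + 1 / 3" using S s norm_E[OF e] \<delta> by (intro add_mono) auto
    finally have "norm x \<le> 4 / 3" by simp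
    moreover have "x \<in> V" unfolding x
      using V S s e Suc by (intro subspace_add subspace_scale) auto
    ultimately show "x \<in> V \<inter> cball 0 (4 / 3)" by simp
  qed
  moreover have "finite (E (Suc k))" using Suc S by (simp add: Suc_E)
  moreover have "card (E (Suc k)) = card S ^ Suc k"
    using Suc S inj by (simp add: Suc_E card_image card_cartesian_product)
  moreover have "pairwise (\<lambda>x y. (\<delta> / 4) ^ Suc k \<le> dist x y) (E (Suc k))"
    unfolding Suc_E q_def[symmetric] pairwise_def using apart by auto
  ultimately show ?case by simp
qed

text \<open>The constant of \<open>card_separated_polynomial\<close> depends on the space; it disappears by tensorisation. An
  \<open>N\<close>-point set yields \<open>N^k\<close> digit sums that are \<open>(\<delta>/4)^k\<close>-separated, so \<open>N^k \<le> C (4/\<delta>)^(nk)\<close> for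
  every \<open>k\<close>, and the \<open>k\<close>-th root kills \<open>C\<close>.\<close>

lemma card_separated_unit_ball:
  fixes V :: "'a::real_normed_vector set"
  assumes V: "subspace V" "dim V = n" "n \<ge> 1" and S: "S \<subseteq> V \<inter> cball 0 1"
    and \<delta>: "0 < \<delta>" "\<delta> \<le> 1" and sep: "pairwise (\<lambda>x y. \<delta> \<le> dist x y) S"
  shows "finite S" "real (card S) \<le> (4 / \<delta>) ^ n"
proof -
  obtain B where B: "B \<subseteq> V" "independent B" "V \<subseteq> span B" "card B = n"
    using basis_exists[of V] V by auto
  \<comment> \<open>The cardinality of an infinite basis is \<open>0\<close>, so \<open>n \<ge> 1\<close> makes the space finite-dimensional.\<close>
  have finB: "finite B" using B V by (metis card.infinite not_one_le_zero)
  have VB: "V \<subseteq> span B" using B by simp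
  have "(0::real) < 4 / 3" by simp
  then obtain C where C: "\<And>S \<eta>. S \<subseteq> span B \<inter> cball 0 (4 / 3) \<Longrightarrow> 0 < \<eta> \<Longrightarrow> \<eta> \<le> 1 \<Longrightarrow>
      pairwise (\<lambda>x y. \<eta> \<le> dist x y) S \<Longrightarrow> finite S \<and> real (card S) \<le> C / \<eta> ^ card B"
    using card_separated_polynomial[OF finB B(2), of "4 / 3"] by blast
  have "S \<subseteq> span B \<inter> cball 0 (4 / 3)" using S VB by fastforce
  then show fin: "finite S" using C[of S \<delta>] \<delta> sep by blast
  define q where "q = \<delta> / 4"
  have q: "q > 0" "q \<le> 1" using \<delta> by (auto simp: q_def)
  define a where "a = real (card S) * q ^ n"
  have "a ^ k \<le> C" for k
  proof -
    note E = digit_sums_separated[OF V(1) S fin \<delta> sep, of k]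
    have "real (card (digit_sums (\<delta> / 4) S k)) \<le> C / (q ^ k) ^ card B"
      by (rule conjunct2[OF C]) (use E VB q in \<open>auto simp: q_def power_le_one\<close>)
    then have "real (card S) ^ k \<le> C / (q ^ k) ^ n" using E B by simp
    then have "real (card S) ^ k * (q ^ k) ^ n \<le> C" using q by (simp add: pos_le_divide_eq)
    then show ?thesis
      by (simp add: a_def power_mult_distrib flip: power_mult) (simp add: mult.commute)
  qed
  then have "\<not> a > 1"
    using real_arch_pow[of a C] by (meson not_le)
  then have "real (card S) \<le> 1 / q ^ n" using q by (simp add: a_def field_simps)
  then show "real (card S) \<le> (4 / \<delta>) ^ n" by (simp add: q_def power_divide)
qed

text \<open>A separated set of maximal cardinality is a net, as any uncovered point could be added to it.\<close>

lemma exists_net_unit_ball: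
  fixes V :: "'a::real_normed_vector set"
  assumes V: "subspace V" "dim V = n" "n \<ge> 1" and \<delta>: "0 < \<delta>" "\<delta> \<le> 1"
  obtains S where "finite S" "S \<noteq> {}" "real (card S) \<le> (4 / \<delta>) ^ n"
    "\<And>v. v \<in> V \<Longrightarrow> norm v \<le> 1 \<Longrightarrow> \<exists>s\<in>S. dist v s < \<delta>"
proof -
  let ?P = "\<lambda>S. S \<subseteq> V \<inter> cball 0 1 \<and> pairwise (\<lambda>x y. \<delta> \<le> dist x y) S"
  have bound: "finite S" "real (card S) \<le> (4 / \<delta>) ^ n" if "?P S" for S
    using card_separated_unit_ball[OF V _ \<delta>] that by auto
  have "?P {}" by (simp add: pairwise_def)
  moreover have "\<forall>S. ?P S \<longrightarrow> card S < Suc (nat \<lfloor>(4 / \<delta>) ^ n\<rfloor>)"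
    using bound(2) le_nat_floor less_Suc_eq_le by blast
  ultimately have "\<exists>S. ?P S \<and> (\<forall>S'. ?P S' \<longrightarrow> card S' \<le> card S)"
    by (rule ex_has_greatest_nat[where P = ?P])
  then obtain S where S: "?P S" and max: "\<forall>S'. ?P S' \<longrightarrow> card S' \<le> card S"
    by auto
  have net: "\<exists>s\<in>S. dist v s < \<delta>" if v: "v \<in> V" "norm v \<le> 1" for v
  proof (rule ccontr)
    assume neg: "\<not> ?thesis"
    then have far: "\<And>s. s \<in> S \<Longrightarrow> \<delta> \<le> dist v s" by (simp add: not_less)
    have "v \<notin> S" using far[of v] \<delta> by auto
    moreover have "?P (insert v S)"
      using S v far by (auto simp: pairwise_insert dist_commute)
    ultimately show False using max[rule_format, of "insert v S"] bound(1)[OF S] by simp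
  qed
  have "S \<noteq> {}" using net[of 0] subspace_0[OF V(1)] by auto
  with S bound net show thesis using that by blast
qed

section \<open>Small widths force small entropy numbers\<close>

text \<open>Approximants of points of \<open>K\<close> have norm at most \<open>1 + \<delta> \<le> 2\<close>, so only the ball of radius \<open>2\<close> of the
  approximating space matters; a \<open>\<delta>\<close>-net of that ball is a \<open>2\<delta>\<close>-net of \<open>K\<close>. After scaling by \<open>1/2\<close> the net has at most
  \<open>(8/\<delta>)^n\<close> points.\<close>

lemma entropy_number_le_of_width_less:
  fixes K :: "'a::real_normed_vector set"
  assumes K: "\<And>f. f \<in> K \<Longrightarrow> norm f \<le> 1" and n: "n \<ge> 1" and \<delta>: "0 < \<delta>" "\<delta> \<le> 1"
    and m: "real n * log 2 (8 / \<delta>) \<le> real m" and width: "kolmogorov_width n K < ereal \<delta>"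
  shows "entropy_number m K \<le> ereal (2 * \<delta>)"
proof -
  obtain V where V: "subspace V" "dim V = n" and sup: "(SUP f\<in>K. ereal (infdist f V)) < ereal \<delta>"
    using width n by (auto simp: kolmogorov_width_def INF_less_iff)
  obtain S where S: "finite S" "S \<noteq> {}" "real (card S) \<le> (4 / (\<delta> / 2)) ^ n"
    and net: "\<And>v. v \<in> V \<Longrightarrow> norm v \<le> 1 \<Longrightarrow> \<exists>s\<in>S. dist v s < \<delta> / 2"
    using exists_net_unit_ball[OF V n, of "\<delta> / 2"] \<delta> by auto
  have near: "\<exists>s\<in>S. dist f (2 *\<^sub>R s) \<le> 2 * \<delta>" if f: "f \<in> K" for f
  proof -
    have ne: "V \<noteq> {}" using subspace_0[OF V(1)] by auto
    have "ereal (infdist f V) < ereal \<delta>"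
      using sup f by (meson SUP_upper order_le_less_trans)
    then have "(INF v\<in>V. dist f v) < \<delta>" using ne by (simp add: infdist_notempty)
    then obtain v where v: "v \<in> V" "dist f v < \<delta>"
      using ne by (subst (asm) cINF_less_iff) auto
    have "norm v \<le> norm f + dist f v"
      by (metis dist_norm norm_minus_commute norm_triangle_sub)
    then have "norm ((1 / 2) *\<^sub>R v) \<le> 1" using K[OF f] v \<delta> by simp
    moreover have "(1 / 2) *\<^sub>R v \<in> V" using V v by (intro subspace_scale)
    ultimately obtain s where s: "s \<in> S" "dist ((1 / 2) *\<^sub>R v) s < \<delta> / 2" using net by blast
    have "dist v (2 *\<^sub>R s) = norm (2 *\<^sub>R ((1 / 2) *\<^sub>R v - s))"
      by (simp add: dist_norm scaleR_diff_right)
    also have "\<dots> = 2 * dist ((1 / 2) *\<^sub>R v) s" by (simp only: norm_scaleR dist_norm)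
    finally have "dist v (2 *\<^sub>R s) = 2 * dist ((1 / 2) *\<^sub>R v) s" .
    then have "dist f (2 *\<^sub>R s) \<le> 2 * \<delta>"
      using dist_triangle[of f "2 *\<^sub>R s" v] v s by linarith
    then show ?thesis using s by blast
  qed
  have "real (card S) \<le> (8 / \<delta>) ^ n" using S by simp
  also have "\<dots> = 2 powr (real n * log 2 (8 / \<delta>))"
    using \<delta> by (simp add: powr_realpow[symmetric] powr_powr[symmetric] mult.commute[of "real n"])
  also have "\<dots> \<le> 2 powr real m" using m by simp
  also have "\<dots> = 2 ^ m" by (simp add: powr_realpow)
  finally have "real (card S) \<le> real (2 ^ m)" by simp
  then have card: "card S \<le> 2 ^ m" by linarith
  obtain g :: "nat \<Rightarrow> 'a" where g: "S \<subseteq> g ` {1..2 ^ m}"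
  proof -
    obtain h where h: "bij_betw h {1..card S} S"
      using ex_bij_betw_nat_finite_1[OF S(1)] by blast
    then have "S = h ` {1..card S}" by (simp add: bij_betw_def)
    also have "\<dots> \<subseteq> h ` {1..2 ^ m}" using card by (intro image_mono) auto
    finally have "S \<subseteq> h ` {1..2 ^ m}" .
    then show thesis by (rule that)
  qed
  have "K \<subseteq> (\<Union>j\<in>{1..2 ^ m}. cball (2 *\<^sub>R g j) (2 * \<delta>))"
  proof
    fix f assume "f \<in> K"
    then obtain s where s: "s \<in> S" "dist f (2 *\<^sub>R s) \<le> 2 * \<delta>" using near by blast
    then obtain j where "j \<in> {1..2 ^ m}" "s = g j" using g by blast
    then show "f \<in> (\<Union>j\<in>{1..2 ^ m}. cball (2 *\<^sub>R g j) (2 * \<delta>))"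
      using s by (auto simp: dist_commute)
  qed
  then show ?thesis
    unfolding entropy_number_def using \<delta>
    by (intro Inf_lower) (auto intro!: exI[of _ "2 * \<delta>"] exI[of _ "\<lambda>j. 2 *\<^sub>R g j"])
qed

text \<open>The contrapositive, in the form in which rates are transferred: a lower bound \<open>h\<close> on one entropy number
  bounds a width from below. Since \<open>K\<close> lies in the unit ball, \<open>h \<le> 1\<close>, whence \<open>\<delta> \<le> 1\<close>.\<close>

lemma width_ge_of_entropy_number_ge:
  fixes K :: "'a::real_normed_vector set"
  assumes K: "\<And>f. f \<in> K \<Longrightarrow> norm f \<le> 1" and n: "n \<ge> 1" and \<delta>: "0 < \<delta>"
    and m: "real n * log 2 (8 / \<delta>) \<le> real m"
    and h: "ereal h \<le> entropy_number m K" "2 * \<delta> < h"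
  shows "ereal \<delta> \<le> kolmogorov_width n K"
proof (rule ccontr)
  assume "\<not> ?thesis"
  then have width: "kolmogorov_width n K < ereal \<delta>" by simp
  have "K \<subseteq> (\<Union>j\<in>{1..2 ^ m :: nat}. cball ((\<lambda>_. 0) j) 1)" using K by auto
  then have "entropy_number m K \<le> ereal 1"
    unfolding entropy_number_def
    by (intro Inf_lower) (auto intro!: exI[of _ 1] exI[of _ "\<lambda>_. 0"])
  then have "ereal h \<le> ereal 1" using h(1) by (rule order_trans[rotated])
  then have "\<delta> \<le> 1" using h(2) \<delta> by simp
  then have "entropy_number m K \<le> ereal (2 * \<delta>)"
    using entropy_number_le_of_width_less[OF K n \<delta> _ m width] by blast
  then have "ereal h \<le> ereal (2 * \<delta>)" using h(1) by (rule order_trans[rotated])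
  then show False using h(2) by simp
qed

section \<open>Transfer of rates\<close>

lemma log2_le_self: "log 2 y \<le> y" if "y > 0" for y :: real
proof -
  have "ln (y / 2) \<le> y / 2 - 1" using that by (intro ln_le_minus_one) auto
  then have "ln y \<le> y / 2 - 1 + ln 2" using that by (simp add: ln_div)
  also have "\<dots> \<le> y / 2" using ln_2_less_1 by simp
  also have "\<dots> \<le> y * ln 2" using that ln2_ge_two_thirds by simp
  finally show ?thesis by (simp add: log_def field_simps)
qed

text \<open>Taking \<open>\<delta> = 2^(-x) L^(\<beta>-\<alpha>) / n^\<alpha>\<close> with \<open>L = log 2 n\<close> gives \<open>log 2 (8/\<delta>) \<le> D L\<close> for a constant \<open>D\<close> linear
  in \<open>x\<close>, so the index is \<open>m \<approx> D n L\<close> and \<open>log 2 m\<close> is comparable to \<open>L\<close>. The entropy bound at \<open>m\<close> then has the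
  order of \<open>\<delta>\<close>, up to a power of \<open>D\<close>, which the factor \<open>2^(-x)\<close> beats for large \<open>x\<close>. The purely
  logarithmic rate is covered as well, with \<open>\<alpha> = 0\<close> and \<open>\<beta>\<close> negative.\<close>

lemma width_ge_log_rate:
  fixes K :: "'a::real_normed_vector set" and \<alpha> \<beta> C :: real
  assumes K: "\<And>f. f \<in> K \<Longrightarrow> norm f \<le> 1" and \<alpha>: "\<alpha> \<ge> 0" and C: "C > 0"
    and ent: "\<And>n. n \<ge> 2 \<Longrightarrow>
      ereal (C * (log 2 (real n) powr \<beta> / real n powr \<alpha>)) \<le> entropy_number n K"
  shows "\<exists>C'>0. \<forall>n\<ge>2. ereal (C' * (log 2 (real n) powr \<beta> /
           (real n powr \<alpha> * log 2 (real n) powr \<alpha>))) \<le> kolmogorov_width n K"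
proof -
  define D0 where "D0 = 3 + \<bar>\<alpha> - \<beta>\<bar> + \<alpha>"
  have "((\<lambda>x::real. 2 * (2 powr (-x) * (4 * (D0 + x)) powr (\<bar>\<beta>\<bar> + \<alpha>))) \<longlongrightarrow> 0) at_top"
    by real_asymp
  then have "\<forall>\<^sub>F x in at_top. 2 * (2 powr (-x) * (4 * (D0 + x)) powr (\<bar>\<beta>\<bar> + \<alpha>)) < C"
    using C by (rule order_tendstoD)
  then have "\<forall>\<^sub>F x in at_top. 2 * (2 powr (-x) * (4 * (D0 + x)) powr (\<bar>\<beta>\<bar> + \<alpha>)) < C \<and> x \<ge> 0"
    using eventually_ge_at_top by (rule eventually_conj)
  then obtain x :: real where x: "x \<ge> 0"
    and small: "2 * (2 powr (-x) * (4 * (D0 + x)) powr (\<bar>\<beta>\<bar> + \<alpha>)) < C"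
    by (auto simp: eventually_at_top_linorder)
  define D where "D = D0 + x"
  have D: "D \<ge> 3" using x \<alpha> by (simp add: D_def D0_def)
  have "ereal (2 powr (-x) * (log 2 (real n) powr \<beta> / (real n powr \<alpha> * log 2 (real n) powr \<alpha>)))
          \<le> kolmogorov_width n K" if n: "n \<ge> 2" for n
  proof -
    define L where "L = log 2 (real n)"
    have L: "L \<ge> 1" using n by (simp add: L_def le_log_iff)
    define \<delta> where "\<delta> = 2 powr (-x) * (L powr \<beta> / (real n powr \<alpha> * L powr \<alpha>))"
    have \<delta>: "\<delta> > 0" using n L by (simp add: \<delta>_def)
    have nL: "real n * L \<ge> 2" using mult_mono[of 2 "real n" 1 L] n L by simp
    have "8 / \<delta> = 2 powr 3 * (2 powr x * (L powr (\<alpha> - \<beta>) * real n powr \<alpha>))"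
      using n L by (simp add: \<delta>_def powr_minus powr_diff field_simps)
    then have "log 2 (8 / \<delta>) = log 2 (2 powr 3 * (2 powr x * (L powr (\<alpha> - \<beta>) * real n powr \<alpha>)))"
      by (simp only:)
    also have "\<dots> = 3 + (x + ((\<alpha> - \<beta>) * log 2 L + \<alpha> * log 2 (real n)))"
      using n L by (simp only: log_mult_pos log_powr mult_pos_pos powr_gt_zero) simp
    finally have "log 2 (8 / \<delta>) = 3 + x + ((\<alpha> - \<beta>) * log 2 L + \<alpha> * L)"
      by (simp add: L_def)
    also have "\<dots> \<le> (3 + x) * L + (\<bar>\<alpha> - \<beta>\<bar> * L + \<alpha> * L)"
    proof (intro add_mono)
      have "0 \<le> log 2 L" "log 2 L \<le> L" using L log2_le_self[of L] by auto
      then show "(\<alpha> - \<beta>) * log 2 L \<le> \<bar>\<alpha> - \<beta>\<bar> * L" by (intro mult_mono) auto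
      show "3 + x \<le> (3 + x) * L" using mult_left_mono[of 1 L "3 + x"] x L by simp
    qed simp
    also have "\<dots> = D * L" by (simp add: D_def D0_def algebra_simps)
    finally have logle: "log 2 (8 / \<delta>) \<le> D * L" .
    define m where "m = nat \<lceil>real n * (D * L)\<rceil>"
    have m1: "real n * (D * L) \<le> real m" unfolding m_def by linarith
    have DnL: "1 \<le> real n * (D * L)"
      using mult_mono[of 1 D 1 "real n * L"] D nL by (simp add: algebra_simps)
    then have "real m \<le> real n * (D * L) + 1" unfolding m_def by linarith
    then have m2: "real m \<le> 2 * D * (real n * L)" using DnL by (simp add: algebra_simps)
    have "1 \<le> D * L" using mult_mono[of 1 D 1 L] D L by simp
    then have "real n * 1 \<le> real n * (D * L)" by (intro mult_left_mono) auto
    then have nm: "n \<le> m" using m1 by linarith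
    have logm1: "L \<le> log 2 (real m)" unfolding L_def using n nm by simp
    have logm2: "log 2 (real m) \<le> 4 * D * L"
    proof -
      have "log 2 (real m) \<le> log 2 (2 * D * (real n * L))"
        using m2 nm n by (intro log_mono) auto
      also have "\<dots> = 1 + log 2 D + (L + log 2 L)"
      proof -
        have "log 2 (2 * D * (real n * L)) = log 2 2 + log 2 D + (log 2 (real n) + log 2 L)"
          using D L n by (simp only: log_mult_pos mult_pos_pos)
        then show ?thesis by (simp add: L_def)
      qed
      also have "\<dots> \<le> 1 + D + (L + L)"
        using log2_le_self[of D] log2_le_self[of L] D L by (intro add_mono) auto
      also have "\<dots> \<le> D * L + D * L + (D * L + D * L)"
      proof (intro add_mono)
        show "D \<le> D * L" using mult_left_mono[of 1 L D] D L by simp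
        show "L \<le> D * L" using mult_right_mono[of 1 D L] D L by simp
        then show "L \<le> D * L" .
        show "1 \<le> D * L" by fact
      qed
      finally show ?thesis by simp
    qed
    \<comment> \<open>Since \<open>\<beta>\<close> may have either sign, both bounds on \<open>log 2 m\<close> are needed.\<close>
    have lower: "C * ((4 * D) powr (- (\<bar>\<beta>\<bar> + \<alpha>)) * (L powr \<beta> / (real n powr \<alpha> * L powr \<alpha>)))
        \<le> C * (log 2 (real m) powr \<beta> / real m powr \<alpha>)"
    proof -
      define t where "t = log 2 (real m) / L"
      have t: "1 \<le> t" "t \<le> 4 * D" using logm1 logm2 L by (auto simp: t_def field_simps)
      have "(4 * D) powr (- \<bar>\<beta>\<bar>) \<le> t powr \<beta>"
      proof (cases "\<beta> \<ge> 0")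
        case True
        have "(4 * D) powr (- \<bar>\<beta>\<bar>) \<le> 1" using D by (simp add: powr_minus_divide ge_one_powr_ge_zero)
        also have "1 \<le> t powr \<beta>" using True t by (simp add: ge_one_powr_ge_zero)
        finally show ?thesis .
      next
        case False
        then show ?thesis using t D by (simp add: powr_mono2')
      qed
      then have "(4 * D) powr (- \<bar>\<beta>\<bar>) * L powr \<beta> \<le> t powr \<beta> * L powr \<beta>"
        by (intro mult_right_mono) auto
      also have "\<dots> = log 2 (real m) powr \<beta>" using t L by (simp add: t_def flip: powr_mult)
      finally have num: "(4 * D) powr (- \<bar>\<beta>\<bar>) * L powr \<beta> \<le> log 2 (real m) powr \<beta>" .
      have "real m \<le> 4 * D * (real n * L)" using m2 D L n by (simp add: mult_nonneg_nonneg)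
      then have "real m powr \<alpha> \<le> (4 * D * (real n * L)) powr \<alpha>" using \<alpha> by (intro powr_mono2) auto
      also have "\<dots> = (4 * D) powr \<alpha> * (real n powr \<alpha> * L powr \<alpha>)"
        using D L by (simp add: powr_mult)
      finally have den: "real m powr \<alpha> \<le> (4 * D) powr \<alpha> * (real n powr \<alpha> * L powr \<alpha>)" .
      have "(4 * D) powr (- (\<bar>\<beta>\<bar> + \<alpha>)) * (L powr \<beta> / (real n powr \<alpha> * L powr \<alpha>)) =
          (4 * D) powr (- \<bar>\<beta>\<bar>) * L powr \<beta> / ((4 * D) powr \<alpha> * (real n powr \<alpha> * L powr \<alpha>))"
        using D by (simp add: powr_diff)
      also have "\<dots> \<le> log 2 (real m) powr \<beta> / real m powr \<alpha>"
        using num den n nm by (intro frac_le) auto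
      finally show ?thesis using C by (intro mult_left_mono) auto
    qed
    have "2 * \<delta> < C * ((4 * D) powr (- (\<bar>\<beta>\<bar> + \<alpha>)) * (L powr \<beta> / (real n powr \<alpha> * L powr \<alpha>)))"
    proof -
      have "2 * 2 powr (-x) < C * (4 * D) powr (- (\<bar>\<beta>\<bar> + \<alpha>))"
        using small D unfolding D_def[symmetric] powr_minus[of _ "\<bar>\<beta>\<bar> + \<alpha>"]
        by (simp add: field_simps)
      then have "2 * 2 powr (-x) * (L powr \<beta> / (real n powr \<alpha> * L powr \<alpha>)) <
          C * (4 * D) powr (- (\<bar>\<beta>\<bar> + \<alpha>)) * (L powr \<beta> / (real n powr \<alpha> * L powr \<alpha>))"
        using n L by (intro mult_strict_right_mono) auto
      then show ?thesis by (simp add: \<delta>_def mult.assoc)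
    qed
    then have "2 * \<delta> < C * (log 2 (real m) powr \<beta> / real m powr \<alpha>)" using lower by linarith
    moreover have "real n * log 2 (8 / \<delta>) \<le> real m"
      using mult_left_mono[OF logle, of "real n"] m1 by simp
    ultimately have "ereal \<delta> \<le> kolmogorov_width n K"
      using width_ge_of_entropy_number_ge[OF K _ \<delta> _ ent[of m]] n nm by simp
    then show ?thesis by (simp add: \<delta>_def L_def)
  qed
  then show ?thesis by (intro exI[of _ "2 powr (-x)"]) simp
qed

text \<open>With \<open>\<gamma> = \<alpha>/(1-\<alpha>)\<close> and \<open>\<delta> = 2^(-x) 2^(-y n^\<gamma>)\<close> the index is \<open>m \<le> (4+x+y) n^(1+\<gamma>)\<close>, and \<open>(1+\<gamma>)\<alpha> = \<gamma>\<close>, so the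
  entropy bound at \<open>m\<close> has the exponent \<open>c (4+x+y)^\<alpha> n^\<gamma>\<close>. Because \<open>\<alpha> < 1\<close>, this is at most \<open>y n^\<gamma>\<close> for
  large \<open>y\<close>.\<close>

lemma width_ge_exponential_rate:
  fixes K :: "'a::real_normed_vector set" and \<alpha> C c :: real
  assumes K: "\<And>f. f \<in> K \<Longrightarrow> norm f \<le> 1" and \<alpha>: "0 < \<alpha>" "\<alpha> < 1" and C: "C > 0" and c: "c > 0"
    and ent: "\<And>n. n \<ge> 1 \<Longrightarrow> ereal (C * 2 powr (- (c * real n powr \<alpha>))) \<le> entropy_number n K"
  shows "\<exists>C' c'. C' > 0 \<and> c' > 0 \<and> (\<forall>n\<ge>1.
           ereal (C' * 2 powr (- (c' * real n powr (\<alpha> / (1 - \<alpha>))))) \<le> kolmogorov_width n K)"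
proof -
  define \<gamma> where "\<gamma> = \<alpha> / (1 - \<alpha>)"
  have \<gamma>: "\<gamma> > 0" "(1 + \<gamma>) * \<alpha> = \<gamma>" using \<alpha> by (auto simp: \<gamma>_def field_simps)
  have "((\<lambda>x::real. 2 * 2 powr (-x)) \<longlongrightarrow> 0) at_top" by real_asymp
  then have "\<forall>\<^sub>F x::real in at_top. 2 * 2 powr (-x) < C" using C by (rule order_tendstoD)
  then have "\<forall>\<^sub>F x::real in at_top. 2 * 2 powr (-x) < C \<and> x \<ge> 0"
    using eventually_ge_at_top by (rule eventually_conj)
  then obtain x :: real where x: "x \<ge> 0" "2 * 2 powr (-x) < C"
    by (auto simp: eventually_at_top_linorder)
  have "((\<lambda>y::real. c * (4 + x + y) powr \<alpha> / y) \<longlongrightarrow> 0) at_top"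
    using \<alpha> by real_asymp
  then have "\<forall>\<^sub>F y in at_top. c * (4 + x + y) powr \<alpha> / y < 1" by (rule order_tendstoD) simp
  then have "\<forall>\<^sub>F y in at_top. c * (4 + x + y) powr \<alpha> / y < 1 \<and> y > 0"
    using eventually_gt_at_top by (rule eventually_conj)
  then obtain y where y: "y > 0" "c * (4 + x + y) powr \<alpha> / y < 1"
    by (auto simp: eventually_at_top_linorder)
  then have cy: "c * (4 + x + y) powr \<alpha> \<le> y" by (simp add: field_simps)
  have "ereal (2 powr (-x) * 2 powr (- (y * real n powr \<gamma>))) \<le> kolmogorov_width n K"
    if n: "n \<ge> 1" for n
  proof -
    define \<delta> where "\<delta> = 2 powr (-x) * 2 powr (- (y * real n powr \<gamma>))"
    have \<delta>: "\<delta> > 0" by (simp add: \<delta>_def)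
    have n\<gamma>: "real n powr \<gamma> \<ge> 1" using n \<gamma> by (simp add: ge_one_powr_ge_zero)
    have "8 / \<delta> = 2 powr (3 + x + y * real n powr \<gamma>)"
      by (simp add: \<delta>_def powr_minus powr_add field_simps)
    then have log8: "log 2 (8 / \<delta>) = 3 + x + y * real n powr \<gamma>" by simp
    define m where "m = nat \<lceil>real n * (3 + x + y * real n powr \<gamma>)\<rceil>"
    have m1: "real n * (3 + x + y * real n powr \<gamma>) \<le> real m" unfolding m_def by linarith
    have inner: "3 + x + y * real n powr \<gamma> \<ge> 1" using x y n\<gamma> by (simp add: add_nonneg_nonneg)
    have "real n * 1 \<le> real n * (3 + x + y * real n powr \<gamma>)"
      using inner by (intro mult_left_mono) auto
    then have m_ge: "m \<ge> 1" using m1 n by linarith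
    have "0 \<le> real n * (3 + x + y * real n powr \<gamma>)"
      using inner by (intro mult_nonneg_nonneg) auto
    then have "real m \<le> real n * (3 + x + y * real n powr \<gamma>) + 1" unfolding m_def by linarith
    also have "\<dots> \<le> real n * (4 + x + y * real n powr \<gamma>)" using n by (simp add: algebra_simps)
    also have "\<dots> \<le> real n * ((4 + x + y) * real n powr \<gamma>)"
      using mult_left_mono[OF n\<gamma>, of "4 + x"] x by (intro mult_left_mono) (auto simp: algebra_simps)
    also have "\<dots> = (4 + x + y) * real n powr (1 + \<gamma>)" using n by (simp add: powr_add)
    finally have "real m powr \<alpha> \<le> ((4 + x + y) * real n powr (1 + \<gamma>)) powr \<alpha>"
      using \<alpha> by (intro powr_mono2) auto
    also have "\<dots> = (4 + x + y) powr \<alpha> * real n powr \<gamma>"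
      using x y \<gamma> by (simp add: powr_mult powr_powr)
    finally have "c * real m powr \<alpha> \<le> c * ((4 + x + y) powr \<alpha> * real n powr \<gamma>)"
      using c by (intro mult_left_mono) auto
    also have "\<dots> \<le> y * real n powr \<gamma>"
      using mult_right_mono[OF cy, of "real n powr \<gamma>"] by (simp add: mult.assoc)
    finally have "2 powr (- (y * real n powr \<gamma>)) \<le> 2 powr (- (c * real m powr \<alpha>))" by simp
    then have "C * 2 powr (- (y * real n powr \<gamma>)) \<le> C * 2 powr (- (c * real m powr \<alpha>))"
      using C by (intro mult_left_mono) auto
    moreover have "2 * \<delta> < C * 2 powr (- (y * real n powr \<gamma>))"
      using mult_strict_right_mono[OF x(2), of "2 powr (- (y * real n powr \<gamma>))"]
      by (simp add: \<delta>_def mult.assoc)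
    ultimately have "2 * \<delta> < C * 2 powr (- (c * real m powr \<alpha>))" by linarith
    then have "ereal \<delta> \<le> kolmogorov_width n K"
      using width_ge_of_entropy_number_ge[OF K n \<delta> _ ent[OF m_ge]] m1 log8 by simp
    then show ?thesis by (simp add: \<delta>_def)
  qed
  then show ?thesis using y(1)
    by (intro exI[of _ "2 powr (-x)"] exI[of _ y]) (simp add: \<gamma>_def)
qed

theorem theorem4p2:
  fixes K :: "'a::banach set"
  assumes "compact K"
    and "(SUP f\<in>K. ereal (norm f)) = 1"
  shows
    "(\<forall>\<alpha> \<beta> C :: real. \<alpha> > 0 \<longrightarrow> C > 0 \<longrightarrow>
        (\<forall>n::nat. n \<ge> 2 \<longrightarrow>
           entropy_number n K \<ge> ereal (C * (log 2 (real n) powr \<beta> / real n powr \<alpha>))) \<longrightarrow>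
        (\<exists>C'::real. C' > 0 \<and> (\<forall>n::nat. n \<ge> 2 \<longrightarrow>
           kolmogorov_width n K \<ge>
             ereal (C' * (log 2 (real n) powr \<beta> / (real n powr \<alpha> * log 2 (real n) powr \<alpha>)))))) \<and>
     (\<forall>\<alpha> C :: real. \<alpha> > 0 \<longrightarrow> C > 0 \<longrightarrow>
        (\<forall>n::nat. n \<ge> 2 \<longrightarrow>
           entropy_number n K \<ge> ereal (C / log 2 (real n) powr \<alpha>)) \<longrightarrow>
        (\<exists>C'::real. C' > 0 \<and> (\<forall>n::nat. n \<ge> 2 \<longrightarrow>
           kolmogorov_width n K \<ge> ereal (C' / log 2 (real n) powr \<alpha>)))) \<and>
     (\<forall>\<alpha> C c :: real. 0 < \<alpha> \<longrightarrow> \<alpha> < 1 \<longrightarrow> C > 0 \<longrightarrow> c > 0 \<longrightarrow>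
        (\<forall>n::nat. n \<ge> 1 \<longrightarrow>
           entropy_number n K \<ge> ereal (C * 2 powr (- (c * real n powr \<alpha>)))) \<longrightarrow>
        (\<exists>C' c' :: real. C' > 0 \<and> c' > 0 \<and> (\<forall>n::nat. n \<ge> 1 \<longrightarrow>
           kolmogorov_width n K \<ge>
             ereal (C' * 2 powr (- (c' * real n powr (\<alpha> / (1 - \<alpha>))))))))"
proof -
  have K: "norm f \<le> 1" if "f \<in> K" for f
  proof -
    have "ereal (norm f) \<le> (SUP f\<in>K. ereal (norm f))" using that by (rule SUP_upper)
    then show ?thesis using assms(2) by simp
  qed
  show ?thesis
  proof (intro conjI allI impI, goal_cases)
    case (1 \<alpha> \<beta> C)
    then show ?case using width_ge_log_rate[OF K, where \<alpha> = \<alpha> and \<beta> = \<beta> and C = C] by auto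
  next
    case (2 \<alpha> C)
    have "ereal (C * (log 2 (real n) powr (- \<alpha>) / real n powr 0)) \<le> entropy_number n K"
      if "n \<ge> 2" for n
      using 2 that by (simp add: powr_minus_divide)
    from width_ge_log_rate[OF K order_refl 2(2) this] obtain C' where C': "C' > 0"
      and w: "\<And>n. n \<ge> 2 \<Longrightarrow> ereal (C' * (log 2 (real n) powr (- \<alpha>) /
        (real n powr 0 * log 2 (real n) powr 0))) \<le> kolmogorov_width n K"
      by auto
    have "ereal (C' / log 2 (real n) powr \<alpha>) \<le> kolmogorov_width n K" if "n \<ge> 2" for n
    proof -
      have "log 2 (real n) > 0" using that by simp
      then have "log 2 (real n) powr 0 = 1" by (metis less_irrefl powr_zero_eq_one)
      from w[OF that, unfolded this] show ?thesis using that by (simp add: powr_minus_divide)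
    qed
    with C' show ?case by blast
  next
    case (3 \<alpha> C c)
    then show ?case using width_ge_exponential_rate[OF K, where \<alpha> = \<alpha> and C = C and c = c] by auto
  qed
qed

end
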